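(* The fully discrete concentrations $c_{1h}^m=\tilde c_{1h}^m+m_0$ and $c_{2h}^m=\tilde c_{2h}^m+m_0$ produced by the fully discrete dG pressure-correction scheme described in the context satisfy, for every time level $m$, the mass conservation property $$\sum_{E\in\mathcal E_h}\int_Ec_{1h}^m\,dx=\sum_{E\in\mathcal E_h}\int_Ec_{10}\,dx=\sum_{E\in\mathcal E_h}\int_Ec_{2h}^m\,dx=\sum_{E\in\mathcal E_h}\int_Ec_{20}\,dx=m_0|\Omega|.$$
   Context: **Data.** $\Omega\subset\mathbb R^2$ is a convex bounded polygonal domain, $T>0$, $\mu,\nu,\kappa_1,\kappa_2>0$ are constants, $\beta_1=1$, $\beta_2=-1$. The scheme approximates, for $i=1,2$, the PNP-NS system $-\mu\Delta\phi=c_1-c_2$; $\partial_tc_i-\kappa_i\Delta c_i+(\mathbf u\cdot\nabla)c_i-\beta_i\nabla\cdot(c_i\nabla\phi)=0$; $\partial_t\mathbf u-\nu\Delta\mathbf u+(\mathbf u\cdot\nabla)\mathbf u+\nabla p=-(c_1-c_2)\nabla\phi$; $\nabla\cdot\mathbf u=0$ in $\Omega\times(0,T]$ with homogeneous Neumann conditions for $c_1,c_2,\phi$, $\mathbf u=0$ on $\partial\Omega$, and initial data $c_{10},c_{20},\mathbf u_0$, where $\int_\Omega c_{10}=\int_\Omega c_{20}$. Set $m_0=\frac1{|\Omega|}\int_\Omega c_{10}\,dx=\frac1{|\Omega|}\int_\Omega c_{20}\,dx$. **Mesh and spaces.** $(\cdot,\cdot)$ is the $L^2(\Omega)$ inner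 product; $L_0^2(\Omega)$ is the set of zero-mean $L^2$ functions. $\mathcal E_h$ is a shape-regular triangulation of $\bar\Omega$ of maximal element diameter $h$; $\Gamma_h^0$ is the set of interior edges, $\Gamma_h=\Gamma_h^0\cup\partial\Omega$ the set of all edges; $h_e=|e|$. Each interior edge $e$ shared by $E_i,E_j$ has a fixed unit normal $\mathbf n_e$ directed from $E_i$ to $E_j$, and $[[\psi]]=\psi|_{E_i}-\psi|_{E_j}$, $\{\{\psi\}\}=\frac12(\psi|_{E_i}+\psi|_{E_j})$; on boundary edges $\mathbf n_e$ is the outward normal and jump and average both equal the value. $\sigma_e>0$ are sufficiently large penalty parameters. For an integer $k\ge1$: $X_h^0=\{\chi\in L^2_0(\Omega):\chi|_E\in\mathbb P_k(E)\ \forall E\}$, $\mathbf V_h=\{\mathbf v\in\mathbf L^2:\mathbf v|_E\in\mathbb P_k(E)^2\ \forall E\}$, $M_h=\{q\in L_0^2(\Omega):q|_E\in\mathbb P_{k-1}(E)\ \forall E\}$. **Forms** (sums over $E$ run over $\mathcal E_h$). $\mathcal A_1(\psi,\chi)=\sum_E\int_E\nabla\psi\cdot\nabla\chi-\sum_{e\in\Gamma_h^0}\int_e\{\{\nabla\psi\}\}\cdot\mathbf n_e[[\chi]]-\sum_{e\in\Gamma_h^0}\int_e\{\{\nabla\chi\}\}\cdot\mathbf n_e[[\psi]]+\sum_{e\in\Gamma_h^0}\frac{\sigma_e}{h_e}\int_e[[\psi]][[\chi]]$; $\mathcal A_2(\mathbf v,\mathbf w)=\sum_E\int_E\nabla\mathbf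 v:\nabla\mathbf w-\sum_{e\in\Gamma_h}\int_e\{\{\nabla\mathbf v\}\}\mathbf n_e\cdot[[\mathbf w]]-\sum_{e\in\Gamma_h}\int_e\{\{\nabla\mathbf w\}\}\mathbf n_e\cdot[[\mathbf v]]+\sum_{e\in\Gamma_h}\frac{\sigma_e}{h_e}\int_e[[\mathbf v]]\cdot[[\mathbf w]]$; $\mathcal D(\mathbf v,q)=\sum_E\int_Eq\,\nabla\cdot\mathbf v-\sum_{e\in\Gamma_h}\int_e\{\{q\}\}\mathbf n_e\cdot[[\mathbf v]]$; $\mathcal N_1(\mathbf v,\psi,\chi)=\sum_E\int_E(\mathbf v\cdot\nabla\psi)\chi+\frac12\sum_E\int_E(\nabla\cdot\mathbf v)\psi\chi-\sum_{e\in\Gamma_h^0}\int_e\{\{\mathbf v\}\}\cdot\mathbf n_e[[\psi]]\{\{\chi\}\}-\frac12\sum_{e\in\Gamma_h^0}\int_e[[\mathbf v]]\cdot\mathbf n_e\{\{\psi\chi\}\}$; $\mathcal N_2(\mathbf v,\mathbf w,\boldsymbol\varphi)=\sum_E\int_E(\mathbf v\cdot\nabla)\mathbf w\cdot\boldsymbol\varphi+\frac12\sum_E\int_E(\nabla\cdot\mathbf v)\mathbf w\cdot\boldsymbol\varphi-\sum_{e\in\Gamma_h}\int_e\{\{\mathbf v\}\}\cdot\mathbf n_e[[\mathbf w]]\cdot\{\{\boldsymbol\varphi\}\}-\frac12\sum_{e\in\Gamma_h}\int_e[[\mathbf v]]\cdot\mathbf n_e\{\{\mathbf w\cdot\boldsymbol\varphi\}\}$;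 $\mathcal G(\chi,\psi,\zeta)=\sum_E\int_E\chi\nabla\psi\cdot\nabla\zeta-\sum_{e\in\Gamma_h^0}\int_e\{\{\chi\nabla\psi\}\}\cdot\mathbf n_e[[\zeta]]-\sum_{e\in\Gamma_h^0}\int_e\{\{\chi\nabla\zeta\}\}\cdot\mathbf n_e[[\psi]]$; $\mathcal T(\chi,\psi,\mathbf w)=\sum_E\int_E\chi\nabla\psi\cdot\mathbf w-\sum_{e\in\Gamma_h^0}\int_e\{\{\chi\}\}[[\psi]]\{\{\mathbf w\}\}\cdot\mathbf n_e$. **Scheme.** $0=t_0<\dots<t_N=T$ is a uniform partition, $t_m=m\Delta t$. Starting from discrete initial data $(\tilde c_{1h}^0,\tilde c_{2h}^0,\mathbf u_h^0,p_h^0)\in X_h^0\times X_h^0\times\mathbf V_h\times M_h$, for $m=1,\dots,N$ find successively $\phi_h^m\in X_h^0$, $\tilde c_{ih}^m\in X_h^0$, $\widehat{\mathbf u}_h^m\in\mathbf V_h$, $p_h^m\in M_h$, $\mathbf u_h^m\in\mathbf V_h$ such that for all $\psi_h,\chi_h\in X_h^0$, $\mathbf v_h,\mathbf w_h\in\mathbf V_h$, $q_h\in M_h$, $i=1,2$: $\mu\mathcal A_1(\phi_h^m,\psi_h)=(\tilde c_{1h}^{m-1}-\tilde c_{2h}^{m-1},\psi_h)$; $\frac1{\Delta t}(\tilde c_{ih}^m-\tilde c_{ih}^{m-1},\chi_h)+\kappa_i\mathcal A_1(\tilde c_{ih}^m,\chi_h)+\mathcal N_1(\mathbf u_h^{m-1},\tilde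 c_{ih}^m,\chi_h)+\beta_i\mathcal G(\tilde c_{ih}^{m-1}+m_0,\phi_h^m,\chi_h)=0$; $\frac1{\Delta t}(\widehat{\mathbf u}_h^m-\mathbf u_h^{m-1},\mathbf v_h)+\nu\mathcal A_2(\widehat{\mathbf u}_h^m,\mathbf v_h)+\mathcal N_2(\mathbf u_h^{m-1},\widehat{\mathbf u}_h^m,\mathbf v_h)-\mathcal D(\mathbf v_h,p_h^{m-1})=-\mathcal T(\tilde c_{1h}^{m-1}-\tilde c_{2h}^{m-1},\phi_h^m,\mathbf v_h)$; $\mathcal A_1(p_h^m-p_h^{m-1},q_h)=-\frac1{\Delta t}\mathcal D(\widehat{\mathbf u}_h^m,q_h)$; $\frac1{\Delta t}(\mathbf u_h^m-\widehat{\mathbf u}_h^m,\mathbf w_h)-\mathcal D(\mathbf w_h,p_h^m-p_h^{m-1})=0$; and set $c_{ih}^m=\tilde c_{ih}^m+m_0$. *)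

theory Defs
  imports "HOL-Analysis.Analysis"
begin

section \<open>Domain, mesh and discrete spaces\<close>

definition convex_polygonal_domain :: "(real^2) set \<Rightarrow> bool" where
  "convex_polygonal_domain \<Omega> \<longleftrightarrow>
     open \<Omega> \<and> \<Omega> \<noteq> {} \<and> convex \<Omega> \<and> bounded \<Omega> \<and> polytope (closure \<Omega>)"

text \<open>An edge \<open>e\<close> shared by \<open>E\<^sub>i\<close> and \<open>E\<^sub>j\<close>, with normal directed from \<open>E\<^sub>i\<close> to \<open>E\<^sub>j\<close>, has
  \<open>edge_from M e = E\<^sub>i\<close> and \<open>edge_to M e = E\<^sub>j\<close>; for a boundary edge, \<open>edge_from M e\<close> is the one
  element having it as an edge and \<open>edge_to M e\<close> is irrelevant.\<close>

record dg_mesh =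
  elements :: "(real^2) set set"
  edge_from :: "(real^2) set \<Rightarrow> (real^2) set"
  edge_to :: "(real^2) set \<Rightarrow> (real^2) set"
  edge_normal :: "(real^2) set \<Rightarrow> real^2"

definition all_edges :: "dg_mesh \<Rightarrow> (real^2) set set" where
  "all_edges M = {e. \<exists>E\<in>elements M. e edge_of E}"

definition interior_edges :: "dg_mesh \<Rightarrow> (real^2) set set" where
  "interior_edges M =
     {e. \<exists>E\<in>elements M. \<exists>E'\<in>elements M. E \<noteq> E' \<and> e edge_of E \<and> e edge_of E'}"

definition outward_unit_normal :: "(real^2) set \<Rightarrow> (real^2) set \<Rightarrow> real^2 \<Rightarrow> bool" where
  "outward_unit_normal E e n \<longleftrightarrow>
     norm n = 1 \<and> (\<forall>x\<in>e. \<forall>y\<in>e. n \<bullet> (y - x) = 0) \<and> (\<forall>x\<in>e. \<forall>y\<in>E. n \<bullet> (y - x) \<le> 0)"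

definition shape_regular :: "real \<Rightarrow> (real^2) set set \<Rightarrow> bool" where
  "shape_regular \<rho> \<E> \<longleftrightarrow> (\<forall>E\<in>\<E>. \<exists>x r. r > 0 \<and> cball x r \<subseteq> E \<and> diameter E \<le> \<rho> * r)"

definition is_dg_mesh :: "(real^2) set \<Rightarrow> real \<Rightarrow> real \<Rightarrow> dg_mesh \<Rightarrow> bool" where
  "is_dg_mesh \<Omega> \<rho> h M \<longleftrightarrow>
     triangulation (elements M) \<and>
     (\<forall>E\<in>elements M. 2 simplex E) \<and>
     \<Union>(elements M) = closure \<Omega> \<and>
     shape_regular \<rho> (elements M) \<and>
     h = Max (diameter ` elements M) \<and>
     (\<forall>e\<in>interior_edges M.
        edge_from M e \<in> elements M \<and> edge_to M e \<in> elements M \<and> edge_from M e \<noteq> edge_to M e \<and>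
        e edge_of edge_from M e \<and> e edge_of edge_to M e) \<and>
     (\<forall>e\<in>all_edges M - interior_edges M.
        edge_from M e \<in> elements M \<and> e edge_of edge_from M e) \<and>
     (\<forall>e\<in>all_edges M. outward_unit_normal (edge_from M e) e (edge_normal M e))"

definition L2 :: "(real^2) set \<Rightarrow> (real^2 \<Rightarrow> 'b::euclidean_space) set" where
  "L2 \<Omega> = {f. f \<in> borel_measurable (lebesgue_on \<Omega>) \<and>
               integrable (lebesgue_on \<Omega>) (\<lambda>x. (norm (f x))\<^sup>2)}"

definition L2_0 :: "(real^2) set \<Rightarrow> (real^2 \<Rightarrow> real) set" where
  "L2_0 \<Omega> = {f \<in> L2 \<Omega>. (LINT x|lebesgue_on \<Omega>. f x) = 0}"

definition L2_inner ::
    "(real^2) set \<Rightarrow> (real^2 \<Rightarrow> 'b::euclidean_space) \<Rightarrow> (real^2 \<Rightarrow> 'b) \<Rightarrow> real" where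
  "L2_inner \<Omega> f g = (LINT x|lebesgue_on \<Omega>. f x \<bullet> g x)"

definition domain_mean :: "(real^2) set \<Rightarrow> (real^2 \<Rightarrow> real) \<Rightarrow> real" where
  "domain_mean \<Omega> f = (1 / measure lebesgue \<Omega>) * (LINT x|lebesgue_on \<Omega>. f x)"

definition poly_deg_le :: "nat \<Rightarrow> (real^2 \<Rightarrow> real) set" where
  "poly_deg_le k =
     {q. \<exists>a. \<forall>x. q x = (\<Sum>(i,j)\<in>{(i,j). i + j \<le> k}. a i j * (x$1) ^ i * (x$2) ^ j)}"

text \<open>An \<open>L\<^sup>2\<close> class of piecewise polynomials is represented by a function that coincides with a
  polynomial on the interior of each triangle. Its values on the edges are immaterial: the forms
  below see them only through one-sided limits and through integrals that ignore null sets.\<close>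

definition piecewise_poly :: "nat \<Rightarrow> dg_mesh \<Rightarrow> (real^2 \<Rightarrow> real) set" where
  "piecewise_poly k M =
     {f. \<forall>E\<in>elements M. \<exists>q\<in>poly_deg_le k. \<forall>x\<in>interior E. f x = q x}"

definition X0h :: "(real^2) set \<Rightarrow> dg_mesh \<Rightarrow> nat \<Rightarrow> (real^2 \<Rightarrow> real) set" where
  "X0h \<Omega> M k = L2_0 \<Omega> \<inter> piecewise_poly k M"

definition Vh :: "(real^2) set \<Rightarrow> dg_mesh \<Rightarrow> nat \<Rightarrow> (real^2 \<Rightarrow> real^2) set" where
  "Vh \<Omega> M k = {v \<in> L2 \<Omega>. \<forall>i. (\<lambda>x. v x $ i) \<in> piecewise_poly k M}"

definition Mh :: "(real^2) set \<Rightarrow> dg_mesh \<Rightarrow> nat \<Rightarrow> (real^2 \<Rightarrow> real) set" where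
  "Mh \<Omega> M k = L2_0 \<Omega> \<inter> piecewise_poly (k - 1) M"


section \<open>Traces, jumps, averages and edge integrals\<close>

definition elem_trace :: "(real^2) set \<Rightarrow> (real^2 \<Rightarrow> 'b::real_normed_vector) \<Rightarrow> real^2 \<Rightarrow> 'b" where
  "elem_trace E g x = Lim (at x within interior E) g"

definition jump ::
    "dg_mesh \<Rightarrow> (real^2) set \<Rightarrow> (real^2 \<Rightarrow> 'b::real_normed_vector) \<Rightarrow> real^2 \<Rightarrow> 'b" where
  "jump M e g x =
     (if e \<in> interior_edges M
      then elem_trace (edge_from M e) g x - elem_trace (edge_to M e) g x
      else elem_trace (edge_from M e) g x)"

definition avg ::
    "dg_mesh \<Rightarrow> (real^2) set \<Rightarrow> (real^2 \<Rightarrow> 'b::real_normed_vector) \<Rightarrow> real^2 \<Rightarrow> 'b" where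
  "avg M e g x =
     (if e \<in> interior_edges M
      then (1/2) *\<^sub>R (elem_trace (edge_from M e) g x + elem_trace (edge_to M e) g x)
      else elem_trace (edge_from M e) g x)"

text \<open>Integral with respect to arc length over a segment; the two possible orders of the
  endpoints give the same value.\<close>

definition edge_integral :: "(real^2) set \<Rightarrow> (real^2 \<Rightarrow> real) \<Rightarrow> real" where
  "edge_integral e f =
     (let (a, b) = (SOME (a, b). e = closed_segment a b)
      in dist a b * (LINT t|lebesgue_on {0..1}. f (linepath a b t)))"

text \<open>The length \<open>h\<^sub>e\<close> of an edge is its diameter.
  For vector fields, \<open>\<nabla>v\<close> is the Jacobian matrix with entries \<open>(\<nabla>v)\<^sub>i\<^sub>j = \<partial>\<^sub>j v\<^sub>i\<close>,
  so that \<open>(v \<cdot> \<nabla>)w = (\<nabla>w) v\<close>, and \<open>\<nabla>v : \<nabla>w\<close> is the inner product of the type \<^typ>\<open>real^2^2\<close>.\<close>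

definition grad :: "(real^2 \<Rightarrow> real) \<Rightarrow> real^2 \<Rightarrow> real^2" where
  "grad f x = (\<chi> i. frechet_derivative f (at x) (axis i 1))"

definition vgrad :: "(real^2 \<Rightarrow> real^2) \<Rightarrow> real^2 \<Rightarrow> real^2^2" where
  "vgrad v x = jacobian v (at x)"

definition dvg :: "(real^2 \<Rightarrow> real^2) \<Rightarrow> real^2 \<Rightarrow> real" where
  "dvg v x = trace (vgrad v x)"


section \<open>Discontinuous Galerkin forms\<close>

definition formA1 ::
    "dg_mesh \<Rightarrow> ((real^2) set \<Rightarrow> real) \<Rightarrow> (real^2 \<Rightarrow> real) \<Rightarrow> (real^2 \<Rightarrow> real) \<Rightarrow> real" where
  "formA1 M \<sigma> \<psi> \<xi> =
     (\<Sum>E\<in>elements M. LINT x|lebesgue_on E. grad \<psi> x \<bullet> grad \<xi> x)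
     - (\<Sum>e\<in>interior_edges M.
          edge_integral e (\<lambda>x. (avg M e (grad \<psi>) x \<bullet> edge_normal M e) * jump M e \<xi> x))
     - (\<Sum>e\<in>interior_edges M.
          edge_integral e (\<lambda>x. (avg M e (grad \<xi>) x \<bullet> edge_normal M e) * jump M e \<psi> x))
     + (\<Sum>e\<in>interior_edges M.
          \<sigma> e / diameter e * edge_integral e (\<lambda>x. jump M e \<psi> x * jump M e \<xi> x))"

definition formA2 ::
    "dg_mesh \<Rightarrow> ((real^2) set \<Rightarrow> real) \<Rightarrow> (real^2 \<Rightarrow> real^2) \<Rightarrow> (real^2 \<Rightarrow> real^2) \<Rightarrow> real" where
  "formA2 M \<sigma> v w =
     (\<Sum>E\<in>elements M. LINT x|lebesgue_on E. vgrad v x \<bullet> vgrad w x)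
     - (\<Sum>e\<in>all_edges M.
          edge_integral e (\<lambda>x. (avg M e (vgrad v) x *v edge_normal M e) \<bullet> jump M e w x))
     - (\<Sum>e\<in>all_edges M.
          edge_integral e (\<lambda>x. (avg M e (vgrad w) x *v edge_normal M e) \<bullet> jump M e v x))
     + (\<Sum>e\<in>all_edges M.
          \<sigma> e / diameter e * edge_integral e (\<lambda>x. jump M e v x \<bullet> jump M e w x))"

definition formD :: "dg_mesh \<Rightarrow> (real^2 \<Rightarrow> real^2) \<Rightarrow> (real^2 \<Rightarrow> real) \<Rightarrow> real" where
  "formD M v q =
     (\<Sum>E\<in>elements M. LINT x|lebesgue_on E. q x * dvg v x)
     - (\<Sum>e\<in>all_edges M.
          edge_integral e (\<lambda>x. avg M e q x * (edge_normal M e \<bullet> jump M e v x)))"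

definition formN1 ::
    "dg_mesh \<Rightarrow> (real^2 \<Rightarrow> real^2) \<Rightarrow> (real^2 \<Rightarrow> real) \<Rightarrow> (real^2 \<Rightarrow> real) \<Rightarrow> real" where
  "formN1 M v \<psi> \<xi> =
     (\<Sum>E\<in>elements M. LINT x|lebesgue_on E. (v x \<bullet> grad \<psi> x) * \<xi> x)
     + 1/2 * (\<Sum>E\<in>elements M. LINT x|lebesgue_on E. dvg v x * \<psi> x * \<xi> x)
     - (\<Sum>e\<in>interior_edges M.
          edge_integral e (\<lambda>x. (avg M e v x \<bullet> edge_normal M e) * jump M e \<psi> x * avg M e \<xi> x))
     - 1/2 * (\<Sum>e\<in>interior_edges M.
          edge_integral e (\<lambda>x. (jump M e v x \<bullet> edge_normal M e) * avg M e (\<lambda>y. \<psi> y * \<xi> y) x))"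

definition formN2 ::
    "dg_mesh \<Rightarrow> (real^2 \<Rightarrow> real^2) \<Rightarrow> (real^2 \<Rightarrow> real^2) \<Rightarrow> (real^2 \<Rightarrow> real^2) \<Rightarrow> real" where
  "formN2 M v w \<phi> =
     (\<Sum>E\<in>elements M. LINT x|lebesgue_on E. (vgrad w x *v v x) \<bullet> \<phi> x)
     + 1/2 * (\<Sum>E\<in>elements M. LINT x|lebesgue_on E. dvg v x * (w x \<bullet> \<phi> x))
     - (\<Sum>e\<in>all_edges M.
          edge_integral e (\<lambda>x. (avg M e v x \<bullet> edge_normal M e) * (jump M e w x \<bullet> avg M e \<phi> x)))
     - 1/2 * (\<Sum>e\<in>all_edges M.
          edge_integral e (\<lambda>x. (jump M e v x \<bullet> edge_normal M e) * avg M e (\<lambda>y. w y \<bullet> \<phi> y) x))"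

definition formG ::
    "dg_mesh \<Rightarrow> (real^2 \<Rightarrow> real) \<Rightarrow> (real^2 \<Rightarrow> real) \<Rightarrow> (real^2 \<Rightarrow> real) \<Rightarrow> real" where
  "formG M \<xi> \<psi> \<zeta> =
     (\<Sum>E\<in>elements M. LINT x|lebesgue_on E. \<xi> x * (grad \<psi> x \<bullet> grad \<zeta> x))
     - (\<Sum>e\<in>interior_edges M.
          edge_integral e (\<lambda>x. (avg M e (\<lambda>y. \<xi> y *\<^sub>R grad \<psi> y) x \<bullet> edge_normal M e) * jump M e \<zeta> x))
     - (\<Sum>e\<in>interior_edges M.
          edge_integral e (\<lambda>x. (avg M e (\<lambda>y. \<xi> y *\<^sub>R grad \<zeta> y) x \<bullet> edge_normal M e) * jump M e \<psi> x))"

definition formT ::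
    "dg_mesh \<Rightarrow> (real^2 \<Rightarrow> real) \<Rightarrow> (real^2 \<Rightarrow> real) \<Rightarrow> (real^2 \<Rightarrow> real^2) \<Rightarrow> real" where
  "formT M \<xi> \<psi> w =
     (\<Sum>E\<in>elements M. LINT x|lebesgue_on E. \<xi> x * (grad \<psi> x \<bullet> w x))
     - (\<Sum>e\<in>interior_edges M.
          edge_integral e (\<lambda>x. avg M e \<xi> x * jump M e \<psi> x * (avg M e w x \<bullet> edge_normal M e)))"



section \<open>The pressure-correction scheme\<close>

text \<open>The species index \<open>i\<close> ranges over \<open>{1, 2}\<close>; \<open>ct i m\<close> is the zero-mean part of the
  concentration of species \<open>i\<close> at time level \<open>m\<close>.\<close>

definition charge_sign :: "nat \<Rightarrow> real" where
  "charge_sign i = (if i = 1 then 1 else -1)"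

definition pressure_correction_scheme ::
    "(real^2) set \<Rightarrow> dg_mesh \<Rightarrow> nat \<Rightarrow> ((real^2) set \<Rightarrow> real) \<Rightarrow> real \<Rightarrow> real \<Rightarrow> (nat \<Rightarrow> real) \<Rightarrow> real \<Rightarrow>
     real \<Rightarrow> nat \<Rightarrow>
     (nat \<Rightarrow> nat \<Rightarrow> real^2 \<Rightarrow> real) \<Rightarrow> (nat \<Rightarrow> real^2 \<Rightarrow> real) \<Rightarrow> (nat \<Rightarrow> real^2 \<Rightarrow> real^2) \<Rightarrow>
     (nat \<Rightarrow> real^2 \<Rightarrow> real) \<Rightarrow> (nat \<Rightarrow> real^2 \<Rightarrow> real^2) \<Rightarrow> bool" where
  "pressure_correction_scheme \<Omega> M k \<sigma> \<mu> \<nu> \<kappa> m0 dt N ct \<phi> uhat p u \<longleftrightarrow>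
     (\<forall>i\<in>{1,2}. ct i 0 \<in> X0h \<Omega> M k) \<and> u 0 \<in> Vh \<Omega> M k \<and> p 0 \<in> Mh \<Omega> M k \<and>
     (\<forall>m\<in>{1..N}.
        \<phi> m \<in> X0h \<Omega> M k \<and> (\<forall>i\<in>{1,2}. ct i m \<in> X0h \<Omega> M k) \<and>
        uhat m \<in> Vh \<Omega> M k \<and> p m \<in> Mh \<Omega> M k \<and> u m \<in> Vh \<Omega> M k \<and>
        (\<forall>\<psi>\<in>X0h \<Omega> M k.
           \<mu> * formA1 M \<sigma> (\<phi> m) \<psi> = L2_inner \<Omega> (\<lambda>x. ct 1 (m-1) x - ct 2 (m-1) x) \<psi>) \<and>
        (\<forall>i\<in>{1,2}. \<forall>\<xi>\<in>X0h \<Omega> M k.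
           1 / dt * L2_inner \<Omega> (\<lambda>x. ct i m x - ct i (m-1) x) \<xi>
           + \<kappa> i * formA1 M \<sigma> (ct i m) \<xi>
           + formN1 M (u (m-1)) (ct i m) \<xi>
           + charge_sign i * formG M (\<lambda>x. ct i (m-1) x + m0) (\<phi> m) \<xi> = 0) \<and>
        (\<forall>v\<in>Vh \<Omega> M k.
           1 / dt * L2_inner \<Omega> (\<lambda>x. uhat m x - u (m-1) x) v
           + \<nu> * formA2 M \<sigma> (uhat m) v
           + formN2 M (u (m-1)) (uhat m) v
           - formD M v (p (m-1))
           = - formT M (\<lambda>x. ct 1 (m-1) x - ct 2 (m-1) x) (\<phi> m) v) \<and>
        (\<forall>q\<in>Mh \<Omega> M k.
           formA1 M \<sigma> (\<lambda>x. p m x - p (m-1) x) q = - (1 / dt) * formD M (uhat m) q) \<and>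
        (\<forall>w\<in>Vh \<Omega> M k.
           1 / dt * L2_inner \<Omega> (\<lambda>x. u m x - uhat m x) w
           - formD M w (\<lambda>x. p m x - p (m-1) x) = 0))"

end

theory Submission
  imports Defs
begin

text \<open>The mass of each species is conserved because the scheme only ever computes the zero-mean part
  of a concentration: conservation is built into the trial space \<open>X0h\<close>, which contains every iterate
  \<open>ct i m\<close>, rather than obtained by testing the discrete equation with a constant. The integral of
  \<open>ct i m\<close> over \<open>\<Omega>\<close> therefore vanishes, and adding the constant \<open>m0\<close> gives a function of total
  mass \<open>m0 * |\<Omega>|\<close>. By the choice of \<open>m0\<close> as a mean value, this is also the mass of the initial
  data.

  What remains is measure theory. The statement sums integrals over the closed triangles, whereas
  the mean values are integrals over the open domain; \<open>sum_integral_triangulation\<close> identifies the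
  two. Two distinct triangles of a triangulation meet in a proper common face, which has lower
  dimension and hence measure zero, so the overlaps do not matter; and the triangles cover the
  closure of \<open>\<Omega>\<close>, which differs from \<open>\<Omega>\<close> by a part of the boundary of a convex set, again of
  measure zero.\<close>

text \<open>The intersection is a face of both elements and a proper one of at least one of them, so its
  affine dimension drops below that of the space.\<close>

lemma negligible_Int_triangulation:
  fixes E E' :: "'a::euclidean_space set"
  assumes "triangulation \<T>" "E \<in> \<T>" "E' \<in> \<T>" "E \<noteq> E'"
    and full: "\<And>S. S \<in> \<T> \<Longrightarrow> int DIM('a) simplex S"
  shows "negligible (E \<inter> E')"
proof -
  have cvx: "convex E" "convex E'"
    using assms by (auto intro: convex_simplex)
  have face: "(E \<inter> E') face_of E" "(E \<inter> E') face_of E'"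
    using assms(1-3) unfolding triangulation_def by (blast, metis Int_commute)
  have dim: "aff_dim E = DIM('a)" "aff_dim E' = DIM('a)"
    using assms by (auto intro: aff_dim_simplex)
  have "E \<inter> E' \<noteq> E \<or> E \<inter> E' \<noteq> E'"
    using \<open>E \<noteq> E'\<close> by blast
  then have "aff_dim (E \<inter> E') < DIM('a)"
    using face_of_aff_dim_lt[OF cvx(1) face(1)] face_of_aff_dim_lt[OF cvx(2) face(2)] dim by auto
  then have "interior (E \<inter> E') = {}"
    using aff_dim_nonempty_interior[of "E \<inter> E'"] by auto
  then show ?thesis
    using cvx by (simp add: negligible_convex_interior convex_Int)
qed

text \<open>The integrand may take arbitrary values on the boundary of \<open>\<Omega>\<close>: the boundary is a null set,
  and by completeness of Lebesgue measure changing a function there keeps it measurable.\<close>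

lemma
  fixes f :: "'a::euclidean_space \<Rightarrow> real"
  assumes "convex \<Omega>" "open \<Omega>" and f: "integrable (lebesgue_on \<Omega>) f"
  shows absolutely_integrable_closure_convex: "f absolutely_integrable_on closure \<Omega>"
    and integral_closure_convex:
      "(LINT x:closure \<Omega>|lebesgue. f x) = (LINT x|lebesgue_on \<Omega>. f x)"
proof -
  have "closure \<Omega> - \<Omega> \<subseteq> frontier \<Omega>"
    using \<open>open \<Omega>\<close> by (simp add: frontier_def interior_open)
  then have neg: "negligible (closure \<Omega> - \<Omega>)"
    using negligible_convex_frontier[OF \<open>convex \<Omega>\<close>] negligible_subset by blast
  have "\<Omega> \<in> sets lebesgue"
    using \<open>open \<Omega>\<close> by simp
  then have f\<Omega>: "f absolutely_integrable_on \<Omega>"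
    and int\<Omega>: "(LINT x|lebesgue_on \<Omega>. f x) = (LINT x:\<Omega>|lebesgue. f x)"
    using f by (simp_all add: set_integrable_def set_lebesgue_integral_def
        integrable_restrict_space integral_restrict_space)
  have negs: "negligible {x \<in> \<Omega> - closure \<Omega>. f x \<noteq> 0}"
    "negligible {x \<in> closure \<Omega> - \<Omega>. f x \<noteq> 0}"
    using closure_subset[of \<Omega>] by (auto intro: negligible_subset[OF neg])
  show fcl: "f absolutely_integrable_on closure \<Omega>"
    using absolutely_integrable_spike_set_eq[OF negs] f\<Omega> by blast
  show "(LINT x:closure \<Omega>|lebesgue. f x) = (LINT x|lebesgue_on \<Omega>. f x)"
    using integral_spike_set[OF negs] int\<Omega>
    by (simp add: set_lebesgue_integral_eq_integral(2)[OF f\<Omega>]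
        set_lebesgue_integral_eq_integral(2)[OF fcl])
qed

text \<open>This is what turns the elementwise sums of the broken setting into integrals over the domain:
  additivity of the integral up to null sets, applied to the overlaps of the elements and to the
  boundary of \<open>\<Omega>\<close>.\<close>

lemma sum_integral_triangulation:
  fixes f :: "'a::euclidean_space \<Rightarrow> real"
  assumes tri: "triangulation \<T>"
    and full: "\<And>S. S \<in> \<T> \<Longrightarrow> int DIM('a) simplex S"
    and cover: "\<Union>\<T> = closure \<Omega>"
    and "convex \<Omega>" "open \<Omega>" and f: "integrable (lebesgue_on \<Omega>) f"
  shows "(\<Sum>E\<in>\<T>. LINT x|lebesgue_on E. f x) = (LINT x|lebesgue_on \<Omega>. f x)"
proof -
  have meas: "E \<in> sets lebesgue" if "E \<in> \<T>" for E
    using that full by (blast intro: lmeasurable_compact fmeasurableD compact_simplex)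
  have "f absolutely_integrable_on closure \<Omega>"
    using absolutely_integrable_closure_convex assms by blast
  then have int: "f absolutely_integrable_on E" if "E \<in> \<T>" for E
    using set_integrable_subset meas[OF that] cover that by blast
  have overlap: "AE x in lebesgue. (x \<in> E \<and> x \<in> E') \<longrightarrow> E = E'"
    if "E \<in> \<T>" "E' \<in> \<T>" for E E'
  proof (cases "E = E'")
    case False
    then have "E \<inter> E' \<in> null_sets lebesgue"
      using negligible_Int_triangulation[OF tri that] full
      by (simp add: negligible_iff_null_sets)
    from AE_not_in[OF this] show ?thesis
      by eventually_elim blast
  qed simp
  have "(\<Sum>E\<in>\<T>. LINT x|lebesgue_on E. f x) = (\<Sum>E\<in>\<T>. LINT x:E|lebesgue. f x)"
    using meas by (intro sum.cong)
      (simp_all add: set_lebesgue_integral_def integral_restrict_space)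
  also have "\<dots> = (LINT x:\<Union>\<T>|lebesgue. f x)"
    using set_integral_finite_UN_AE[where I = \<T> and A = "\<lambda>E. E" and M = lebesgue,
        OF _ overlap meas int] tri
    by (simp add: triangulation_def)
  also have "\<dots> = (LINT x|lebesgue_on \<Omega>. f x)"
    using integral_closure_convex assms by simp
  finally show ?thesis .
qed

lemma L2_imp_integrable:
  fixes f :: "real^2 \<Rightarrow> real"
  assumes "f \<in> L2 \<Omega>" "\<Omega> \<in> lmeasurable"
  shows "integrable (lebesgue_on \<Omega>) f"
proof -
  interpret finite_measure "lebesgue_on \<Omega>"
    using assms(2) by (rule finite_measure_lebesgue_on)
  have "f \<in> borel_measurable (lebesgue_on \<Omega>)" "integrable (lebesgue_on \<Omega>) (\<lambda>x. (f x)\<^sup>2)"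
    using assms(1) unfolding L2_def by (simp_all only: mem_Collect_eq real_norm_def power2_abs)
  then show ?thesis
    by (rule square_integrable_imp_integrable)
qed

theorem lemma3p6:
  fixes \<Omega> :: "(real^2) set"
    and M :: dg_mesh
    and T \<mu> \<nu> \<rho> h m0 dt :: real
    and \<kappa> :: "nat \<Rightarrow> real"
    and \<sigma> :: "(real^2) set \<Rightarrow> real"
    and k N m :: nat
    and c0 :: "nat \<Rightarrow> real^2 \<Rightarrow> real"
    and c ct :: "nat \<Rightarrow> nat \<Rightarrow> real^2 \<Rightarrow> real"
    and \<phi> p :: "nat \<Rightarrow> real^2 \<Rightarrow> real"
    and u uhat :: "nat \<Rightarrow> real^2 \<Rightarrow> real^2"
  assumes "convex_polygonal_domain \<Omega>"
    and "T > 0" "\<mu> > 0" "\<nu> > 0" "\<kappa> 1 > 0" "\<kappa> 2 > 0"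
    and "integrable (lebesgue_on \<Omega>) (c0 1)" "integrable (lebesgue_on \<Omega>) (c0 2)"
    and "(LINT x|lebesgue_on \<Omega>. c0 1 x) = (LINT x|lebesgue_on \<Omega>. c0 2 x)"
    and "m0 = domain_mean \<Omega> (c0 1)"
    and "is_dg_mesh \<Omega> \<rho> h M"
    and "\<forall>e\<in>all_edges M. \<sigma> e > 0"
    and "k \<ge> 1" "N \<ge> 1" "dt = T / real N"
    and "pressure_correction_scheme \<Omega> M k \<sigma> \<mu> \<nu> \<kappa> m0 dt N ct \<phi> uhat p u"
    and "\<forall>i\<in>{1,2}. \<forall>n\<le>N. \<forall>x. c i n x = ct i n x + m0"
    and "m \<le> N"
  shows "(\<Sum>E\<in>elements M. LINT x|lebesgue_on E. c 1 m x)
           = (\<Sum>E\<in>elements M. LINT x|lebesgue_on E. c0 1 x)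
       \<and> (\<Sum>E\<in>elements M. LINT x|lebesgue_on E. c0 1 x)
           = (\<Sum>E\<in>elements M. LINT x|lebesgue_on E. c 2 m x)
       \<and> (\<Sum>E\<in>elements M. LINT x|lebesgue_on E. c 2 m x)
           = (\<Sum>E\<in>elements M. LINT x|lebesgue_on E. c0 2 x)
       \<and> (\<Sum>E\<in>elements M. LINT x|lebesgue_on E. c0 2 x) = m0 * measure lebesgue \<Omega>"
proof -
  have dom: "open \<Omega>" "convex \<Omega>" "bounded \<Omega>" "\<Omega> \<noteq> {}"
    using assms(1) by (auto simp: convex_polygonal_domain_def)
  have lm: "\<Omega> \<in> lmeasurable"
    using dom by (simp add: lmeasurable_open)
  have sum_eq: "(\<Sum>E\<in>elements M. LINT x|lebesgue_on E. f x) = (LINT x|lebesgue_on \<Omega>. f x)"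
    if "integrable (lebesgue_on \<Omega>) f" for f :: "real^2 \<Rightarrow> real"
    using assms(11) dom that
    by (intro sum_integral_triangulation) (auto simp: is_dg_mesh_def)
  \<comment> \<open>The mean value is a quotient by this measure; only a nonzero one can be cancelled.\<close>
  have "measure lebesgue \<Omega> \<noteq> 0"
    using open_not_negligible[OF dom(1,4)] lm by (simp add: negligible_iff_measure)
  then have init: "(LINT x|lebesgue_on \<Omega>. c0 1 x) = m0 * measure lebesgue \<Omega>"
    by (simp add: assms(10) domain_mean_def)
  have mass: "integrable (lebesgue_on \<Omega>) (c i m)
      \<and> (LINT x|lebesgue_on \<Omega>. c i m x) = m0 * measure lebesgue \<Omega>" if i: "i \<in> {1,2}" for i
  proof -
    interpret finite_measure "lebesgue_on \<Omega>"
      using lm by (rule finite_measure_lebesgue_on)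
    have "ct i m \<in> X0h \<Omega> M k"
    proof (cases "m = 0")
      case True
      then show ?thesis
        using assms(16) i unfolding pressure_correction_scheme_def by blast
    next
      case False
      then have "m \<in> {1..N}"
        using assms(18) by simp
      then show ?thesis
        using assms(16) i unfolding pressure_correction_scheme_def by blast
    qed
    then have ct: "integrable (lebesgue_on \<Omega>) (ct i m)" "(LINT x|lebesgue_on \<Omega>. ct i m x) = 0"
      using lm by (auto simp: X0h_def L2_0_def intro: L2_imp_integrable)
    have c: "c i m = (\<lambda>x. ct i m x + m0)"
      using assms(17,18) i by blast
    show ?thesis
      using ct dom(1) by (simp add: c measure_restrict_space)
  qed
  show ?thesis
    using mass[of 1] mass[of 2] init assms(7-9) by (simp add: sum_eq)
qed

end
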